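(* Let $n\ge 3$ be an integer and $r>0$. The fourth moment of the distance between two uniformly and independently distributed random points in the regular polygon $\mathcal{P}_{n,r}$ is $$M_4(\mathcal{P}_{n,r})=\frac{r^4}{90}\left(77+64\cos\frac{2\pi}{n}+9\cos\frac{4\pi}{n}\right).$$
   Context: $\mathcal{P}_{n,r}$ is the (filled) regular polygon with $n$ sides whose circumscribed circle has radius $r$. $M_m(\mathcal{P}_{n,r})=\mathbb{E}[\varDelta_{n,r}^m]$, where $\varDelta_{n,r}$ is the Euclidean distance between two points chosen independently and uniformly (w.r.t. area) from $\mathcal{P}_{n,r}$. *)

theory Defs
  imports "HOL-Probability.Probability"
begin

text \<open>The Euclidean plane is the type \<^typ>\<open>complex\<close>, whose metric is the Euclidean distance and
  whose \<^term>\<open>lborel\<close> is the area measure. The polygon is placed with its centre at the origin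
  and one vertex on the positive real axis; distances are unaffected by this choice.\<close>

definition regular_polygon :: "nat \<Rightarrow> real \<Rightarrow> complex set" where
  "regular_polygon n r = convex hull {of_real r * cis (2 * pi * real k / real n) | k. k < n}"

text \<open>The joint law of two independent uniform points is the product of their laws.\<close>

definition distance_moment :: "nat \<Rightarrow> 'a::euclidean_space set \<Rightarrow> real" where
  "distance_moment m K =
     (LINT (x, y)|(uniform_measure lborel K \<Otimes>\<^sub>M uniform_measure lborel K). dist x y ^ m)"

lemma (in prob_space) distance_moment_eq_expectation:
  fixes X Y :: "'a \<Rightarrow> 'b::euclidean_space"
  assumes "indep_var borel X borel Y"
    and "distr M borel X = uniform_measure lborel K"
    and "distr M borel Y = uniform_measure lborel K"
  shows "expectation (\<lambda>\<omega>. dist (X \<omega>) (Y \<omega>) ^ m) = distance_moment m K"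
proof -
  have XY: "distr M borel X \<Otimes>\<^sub>M distr M borel Y =
      distr M (borel \<Otimes>\<^sub>M borel) (\<lambda>\<omega>. (X \<omega>, Y \<omega>))"
    and [measurable]: "X \<in> borel_measurable M" "Y \<in> borel_measurable M"
    using assms(1) by (auto simp: indep_var_distribution_eq)
  have "distance_moment m K =
      (LINT (x, y)|(distr M borel X \<Otimes>\<^sub>M distr M borel Y). dist x y ^ m)"
    by (simp add: distance_moment_def assms(2,3))
  also have "\<dots> = expectation (\<lambda>\<omega>. dist (X \<omega>) (Y \<omega>) ^ m)"
    unfolding XY by (subst integral_distr) auto
  finally show ?thesis ..
qed

end

theory Submission
  imports Defs
begin

text \<open>
  Let \<open>X, Y\<close> be the two random points and \<open>m\<^sub>k\<close> the mean of \<open>\<bar>X\<bar>\<^sup>k\<close>. Expanding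
  \<open>\<bar>x - y\<bar>\<^sup>4\<close> in complex notation, every term other than \<open>\<bar>x\<bar>\<^sup>4 + \<bar>y\<bar>\<^sup>4 + 4 \<bar>x\<bar>\<^sup>2 \<bar>y\<bar>\<^sup>2\<close> is
  linear in one of \<open>y\<close>, \<open>y\<^sup>2\<close>, \<open>\<bar>y\<bar>\<^sup>2 y\<close>, whose means vanish because the polygon is invariant under
  rotation by \<open>2 * pi / n\<close> with \<open>n \<ge> 3\<close>. So the fourth moment is \<open>2 m\<^sub>4 + 4 m\<^sub>2\<^sup>2\<close>. The sector spanned
  by two consecutive vertices and its rotations tile the plane, and the sector meets the polygon in
  a linear image of the standard triangle; there \<open>m\<^sub>2\<close> and \<open>m\<^sub>4\<close> reduce to the Dirichlet integrals
  of \<open>s\<^sup>a t\<^sup>b\<close>.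
\<close>

subsection \<open>Lebesgue measure on the complex plane\<close>

text \<open>Lebesgue measure is determined by its values on boxes, and the preimage of a complex box
  is a product of two open intervals. This opens the way to iterated integration over real and
  imaginary parts.\<close>

lemma lborel_complex:
  "(lborel :: complex measure) = distr (lborel \<Otimes>\<^sub>M lborel) borel (\<lambda>(x, y). Complex x y)"
proof (rule lborel_eqI)
  fix l u :: complex
  assume le: "\<And>b. b \<in> Basis \<Longrightarrow> l \<bullet> b \<le> u \<bullet> b"
  have [measurable]: "(\<lambda>(x, y). Complex x y) \<in> borel_measurable (lborel \<Otimes>\<^sub>M lborel)"
    by (simp add: borel_measurable_complex_iff split_beta)
  have box: "(\<lambda>(x, y). Complex x y) -` box l u \<inter> space (lborel \<Otimes>\<^sub>M lborel) =
      {Re l<..<Re u} \<times> {Im l<..<Im u}"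
    by (auto simp: box_def Basis_complex_def space_pair_measure)
  have "Re l \<le> Re u" "Im l \<le> Im u"
    using le[of 1] le[of \<i>] by (auto simp: Basis_complex_def)
  then show "emeasure (distr (lborel \<Otimes>\<^sub>M lborel) borel (\<lambda>(x, y). Complex x y)) (box l u) =
      ennreal (\<Prod>b\<in>Basis. (u - l) \<bullet> b)"
    by (simp add: emeasure_distr box lborel.emeasure_pair_measure_Times Basis_complex_def ennreal_mult)
qed simp

lemma borel_measurable_Complex [measurable (raw)]:
  assumes [measurable]: "f \<in> borel_measurable M" "g \<in> borel_measurable M"
  shows "(\<lambda>x. Complex (f x) (g x)) \<in> borel_measurable M"
  by (simp add: borel_measurable_complex_iff)

lemma nn_integral_complex:
  fixes f :: "complex \<Rightarrow> ennreal"
  assumes [measurable]: "f \<in> borel_measurable borel"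
  shows "(\<integral>\<^sup>+z. f z \<partial>lborel) = (\<integral>\<^sup>+x. \<integral>\<^sup>+y. f (Complex x y) \<partial>lborel \<partial>lborel)"
    and "(\<integral>\<^sup>+z. f z \<partial>lborel) = (\<integral>\<^sup>+y. \<integral>\<^sup>+x. f (Complex x y) \<partial>lborel \<partial>lborel)"
proof -
  show "(\<integral>\<^sup>+z. f z \<partial>lborel) = (\<integral>\<^sup>+x. \<integral>\<^sup>+y. f (Complex x y) \<partial>lborel \<partial>lborel)"
    by (subst lborel_complex)
       (simp add: nn_integral_distr lborel.nn_integral_fst[symmetric] split_beta)
  then show "(\<integral>\<^sup>+z. f z \<partial>lborel) = (\<integral>\<^sup>+y. \<integral>\<^sup>+x. f (Complex x y) \<partial>lborel \<partial>lborel)"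
    by (subst lborel_pair.Fubini') auto
qed

text \<open>The linear map is a composition of two one-variable substitutions:
  \<open>y = c / a * x + e * t\<close> at fixed \<open>x\<close>, then, after exchanging the
  integrals, \<open>x = b * t + a * s\<close> at fixed \<open>t\<close>. Their Jacobians
  \<open>\<bar>e\<bar>\<close> and \<open>\<bar>a\<bar>\<close> multiply to the determinant.\<close>

lemma nn_integral_plane_linear_nonzero:
  fixes a b c d :: real and f :: "real \<Rightarrow> real \<Rightarrow> ennreal"
  assumes [measurable]: "case_prod f \<in> borel_measurable borel"
    and a: "a \<noteq> 0" and D: "a * d - b * c \<noteq> 0"
  shows "(\<integral>\<^sup>+x. \<integral>\<^sup>+y. f x y \<partial>lborel \<partial>lborel) =
    ennreal \<bar>a * d - b * c\<bar> * (\<integral>\<^sup>+t. \<integral>\<^sup>+s. f (a * s + b * t) (c * s + d * t) \<partial>lborel \<partial>lborel)"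
proof -
  \<comment> \<open>\<open>e\<close> is the Schur complement \<open>d - b * c / a\<close>, the
    coefficient of \<open>t\<close> left in the second coordinate once \<open>x\<close> is
    eliminated.\<close>
  define e where "e = (a * d - b * c) / a"
  have e: "e \<noteq> 0" and ae: "\<bar>a * d - b * c\<bar> = \<bar>e\<bar> * \<bar>a\<bar>"
    using a D by (auto simp: e_def abs_mult)
  have [measurable]: "(\<lambda>x. f (g x) (h x)) \<in> borel_measurable M"
    if [measurable]: "g \<in> borel_measurable M" "h \<in> borel_measurable M" for g h and M :: "'x measure"
    using measurable_compose[OF _ assms(1), of "\<lambda>x. (g x, h x)" M] by simp
  have "(\<integral>\<^sup>+x. \<integral>\<^sup>+y. f x y \<partial>lborel \<partial>lborel) =
      (\<integral>\<^sup>+x. \<bar>e\<bar> * (\<integral>\<^sup>+t. f x (c / a * x + e * t) \<partial>lborel) \<partial>lborel)"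
    using e by (intro nn_integral_cong nn_integral_real_affine) auto
  also have "\<dots> = \<bar>e\<bar> * (\<integral>\<^sup>+x. \<integral>\<^sup>+t. f x (c / a * x + e * t) \<partial>lborel \<partial>lborel)"
    by (simp add: nn_integral_cmult)
  also have "\<dots> = \<bar>e\<bar> * (\<integral>\<^sup>+t. \<integral>\<^sup>+x. f x (c / a * x + e * t) \<partial>lborel \<partial>lborel)"
    by (subst lborel_pair.Fubini') auto
  also have "\<dots> = \<bar>e\<bar> * (\<integral>\<^sup>+t. \<bar>a\<bar> * (\<integral>\<^sup>+s. f (b * t + a * s) (c / a * (b * t + a * s) + e * t) \<partial>lborel) \<partial>lborel)"
    using a by (intro arg_cong2[of _ _ _ _ "(*)"] nn_integral_cong nn_integral_real_affine) auto
  also have "\<dots> = \<bar>a * d - b * c\<bar> *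
      (\<integral>\<^sup>+t. \<integral>\<^sup>+s. f (b * t + a * s) (c / a * (b * t + a * s) + e * t) \<partial>lborel \<partial>lborel)"
    by (simp add: nn_integral_cmult ae ennreal_mult mult.assoc)
  also have "(\<lambda>t s. f (b * t + a * s) (c / a * (b * t + a * s) + e * t)) =
      (\<lambda>t s. f (a * s + b * t) (c * s + d * t))"
  proof (intro ext)
    fix t s
    have "c / a * (b * t + a * s) + e * t = c * s + d * t"
      using a by (simp add: e_def field_simps)
    then show "f (b * t + a * s) (c / a * (b * t + a * s) + e * t) = f (a * s + b * t) (c * s + d * t)"
      by (simp add: add.commute)
  qed
  finally show ?thesis .
qed

lemma nn_integral_complex_linear:
  fixes a b c d :: real and f :: "complex \<Rightarrow> ennreal"
  assumes [measurable]: "f \<in> borel_measurable borel" and D: "a * d - b * c \<noteq> 0"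
  shows "(\<integral>\<^sup>+z. f z \<partial>lborel) = ennreal \<bar>a * d - b * c\<bar> *
    (\<integral>\<^sup>+z. f (Complex (a * Re z + b * Im z) (c * Re z + d * Im z)) \<partial>lborel)"
proof (cases "a = 0")
  case False
  have "(\<integral>\<^sup>+z. f z \<partial>lborel) = (\<integral>\<^sup>+x. \<integral>\<^sup>+y. f (Complex x y) \<partial>lborel \<partial>lborel)"
    by (simp add: nn_integral_complex(1))
  also have "\<dots> = ennreal \<bar>a * d - b * c\<bar> *
      (\<integral>\<^sup>+t. \<integral>\<^sup>+s. f (Complex (a * s + b * t) (c * s + d * t)) \<partial>lborel \<partial>lborel)"
    using False D by (intro nn_integral_plane_linear_nonzero) (auto simp: borel_prod[symmetric])
  also have "(\<integral>\<^sup>+t. \<integral>\<^sup>+s. f (Complex (a * s + b * t) (c * s + d * t)) \<partial>lborel \<partial>lborel) =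
      (\<integral>\<^sup>+z. f (Complex (a * Re z + b * Im z) (c * Re z + d * Im z)) \<partial>lborel)"
    by (simp add: nn_integral_complex(2))
  finally show ?thesis .
next
  case True
  have "(\<integral>\<^sup>+z. f z \<partial>lborel) = (\<integral>\<^sup>+x. \<integral>\<^sup>+y. f (Complex x y) \<partial>lborel \<partial>lborel)"
    by (simp add: nn_integral_complex(1))
  \<comment> \<open>Here \<open>b\<close> is nonzero, since the determinant is. Swapping the columns
    of the matrix makes it the pivot and only exchanges the names of the integration
    variables.\<close>
  also have "\<dots> = ennreal \<bar>b * c - a * d\<bar> *
      (\<integral>\<^sup>+t. \<integral>\<^sup>+s. f (Complex (b * s + a * t) (d * s + c * t)) \<partial>lborel \<partial>lborel)"
    using True D by (intro nn_integral_plane_linear_nonzero) (auto simp: borel_prod[symmetric])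
  also have "(\<integral>\<^sup>+t. \<integral>\<^sup>+s. f (Complex (b * s + a * t) (d * s + c * t)) \<partial>lborel \<partial>lborel) =
      (\<integral>\<^sup>+z. f (Complex (a * Re z + b * Im z) (c * Re z + d * Im z)) \<partial>lborel)"
    by (simp add: nn_integral_complex(1) add.commute)
  finally show ?thesis by (simp add: abs_minus_commute)
qed

text \<open>A rotation matrix has determinant \<open>1\<close> by the Pythagorean identity.\<close>

lemma distr_lborel_cis_mult: "distr lborel borel (\<lambda>z. cis x * z) = lborel"
proof (rule measure_eqI)
  fix A :: "complex set" assume "A \<in> sets (distr lborel borel (\<lambda>z. cis x * z))"
  then have [measurable]: "A \<in> sets borel" by simp
  have "emeasure lborel A = (\<integral>\<^sup>+z. indicator A z \<partial>lborel)" by simp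
  also have "\<dots> = ennreal \<bar>cos x * cos x - - sin x * sin x\<bar> *
      (\<integral>\<^sup>+z. indicator A (Complex (cos x * Re z + - sin x * Im z) (sin x * Re z + cos x * Im z)) \<partial>lborel)"
    by (rule nn_integral_complex_linear) (auto simp flip: power2_eq_square)
  also have "(\<lambda>z. Complex (cos x * Re z + - sin x * Im z) (sin x * Re z + cos x * Im z)) = (\<lambda>z. cis x * z)"
    by (auto simp: complex_eq_iff)
  also have "ennreal \<bar>cos x * cos x - - sin x * sin x\<bar> = 1"
    by (simp flip: power2_eq_square)
  also have "(\<integral>\<^sup>+z. indicator A (cis x * z) \<partial>lborel) = emeasure (distr lborel borel (\<lambda>z. cis x * z)) A"
    by (subst nn_integral_distr[symmetric, where M'=borel and f="indicator A"]) auto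
  finally show "emeasure (distr lborel borel (\<lambda>z. cis x * z)) A = emeasure lborel A" by simp
qed simp

subsection \<open>Dirichlet integrals over the triangle\<close>

lemma has_integral_Beta_nat:
  "((\<lambda>t::real. t ^ a * (1 - t) ^ b) has_integral fact a * fact b / fact (a + b + 1)) {0..1}"
proof -
  have "((\<lambda>t. t powr (real (Suc a) - 1) * (1 - t) powr (real (Suc b) - 1)) has_integral
      Beta (real (Suc a)) (real (Suc b))) {0..1}"
    by (rule has_integral_Beta_real) auto
  moreover have "Beta (real (Suc a)) (real (Suc b)) = fact a * fact b / fact (a + b + 1)"
    using Gamma_fact[of a, where 'a=real] Gamma_fact[of b, where 'a=real]
      Gamma_fact[of "a + b + 1", where 'a=real]
    by (simp add: Beta_def add_ac)
  ultimately show ?thesis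
    \<comment> \<open>The two integrands may differ at the endpoints, because
      \<open>0 powr 0 = 0\<close> whereas \<open>0 ^ 0 = 1\<close>.\<close>
    by (simp only:) (erule has_integral_spike_finite[of "{0, 1}", rotated 2], auto simp: powr_realpow)
qed

text \<open>The strict inequality matches the half-open sectors below, whose rotations are disjoint.\<close>

definition unit_simplex :: "complex set" where
  "unit_simplex = {z. 0 < Re z \<and> 0 \<le> Im z \<and> Re z + Im z \<le> 1}"

lemma unit_simplex_borel [measurable]: "unit_simplex \<in> sets borel"
  unfolding unit_simplex_def by measurable

text \<open>Integrating over the real part first leaves
  \<open>y ^ b * (1 - y) ^ Suc a / Suc a\<close>, which is a Beta integral in
  \<open>y\<close>.\<close>

lemma has_bochner_integral_unit_simplex:
  "has_bochner_integral lborel (\<lambda>z. Re z ^ a * Im z ^ b * indicator unit_simplex z)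
     (fact a * fact b / fact (a + b + 2))"
proof (rule has_bochner_integral_nn_integral)
  have inner: "(\<integral>\<^sup>+x. ennreal (x ^ a * y ^ b * indicator unit_simplex (Complex x y)) \<partial>lborel) =
      ennreal (y ^ b * (1 - y) ^ Suc a / real (Suc a) * indicator {0..1} y)" for y
  proof (cases "y \<in> {0..1}")
    case True
    \<comment> \<open>The slice at height \<open>y\<close> is open at \<open>0\<close>; discarding
      that null point turns it into a closed interval.\<close>
    have "AE x in lborel. x \<noteq> (0::real)" by (rule AE_lborel_singleton)
    then have "(\<integral>\<^sup>+x. ennreal (x ^ a * y ^ b * indicator unit_simplex (Complex x y)) \<partial>lborel) =
        (\<integral>\<^sup>+x. ennreal (x ^ a * y ^ b) * indicator {0..1 - y} x \<partial>lborel)"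
      using True
      by (intro nn_integral_cong_AE)
         (auto elim!: eventually_mono simp: unit_simplex_def split: split_indicator)
    also have "\<dots> = ennreal ((1 - y) ^ Suc a / real (Suc a) * y ^ b - 0 ^ Suc a / real (Suc a) * y ^ b)"
    proof (rule nn_integral_FTC_Icc)
      show "((\<lambda>x. x ^ Suc a / real (Suc a) * y ^ b) has_real_derivative x ^ a * y ^ b) (at x)" for x
        by (rule derivative_eq_intros refl | simp del: of_nat_Suc)+
    qed (use True in auto)
    finally show ?thesis using True by (simp add: mult_ac)
  next
    case False
    then have "indicator unit_simplex (Complex x y) = (0::real)" for x
      by (auto simp: unit_simplex_def split: split_indicator)
    with False show ?thesis by simp
  qed
  have "(\<integral>\<^sup>+z. ennreal (Re z ^ a * Im z ^ b * indicator unit_simplex z) \<partial>lborel) =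
      (\<integral>\<^sup>+y. ennreal (y ^ b * (1 - y) ^ Suc a / real (Suc a) * indicator {0..1} y) \<partial>lborel)"
    by (simp add: nn_integral_complex(2) inner)
  also have "\<dots> = (\<integral>\<^sup>+y. ennreal (indicator {0..1} y * (y ^ b * (1 - y) ^ Suc a / real (Suc a))) \<partial>lborel)"
    by (simp add: mult_ac)
  also have "\<dots> = ennreal (fact b * fact (Suc a) / fact (b + Suc a + 1) / real (Suc a))"
    using has_integral_divide[OF has_integral_Beta_nat[of b "Suc a"], of "real (Suc a)"]
    by (intro nn_integral_has_integral_lebesgue) auto
  also have "fact b * fact (Suc a) / fact (b + Suc a + 1) / real (Suc a) =
      (fact a * fact b / fact (a + b + 2) :: real)"
  proof -
    have "b + Suc a + 1 = a + b + 2" by simp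
    moreover have "fact (Suc a) = real (Suc a) * fact a" by (rule fact_Suc)
    ultimately show ?thesis by (simp only:) (simp del: of_nat_Suc)
  qed
  finally show "(\<integral>\<^sup>+z. ennreal (Re z ^ a * Im z ^ b * indicator unit_simplex z) \<partial>lborel) =
      ennreal (fact a * fact b / fact (a + b + 2))" .
qed (auto simp: unit_simplex_def split: split_indicator)

subsection \<open>Geometry of the regular polygon\<close>

text \<open>The rotation permutes the vertices, and taking convex hulls commutes with linear maps.
  The inverse rotation gives the converse.\<close>

lemma regular_polygon_mult_cis:
  assumes "n > 0"
  shows "cis (2 * pi * real j / real n) * z \<in> regular_polygon n r \<longleftrightarrow> z \<in> regular_polygon n r"
proof -
  define w where "w j = cis (2 * pi * real_of_int j / real n)" for j
  have w_add: "w (i + j) = w i * w j" for i j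
    by (simp add: w_def cis_mult add_divide_distrib algebra_simps)
  have w_n: "w (int n * j) = 1" for j
  proof -
    have "2 * pi * real_of_int (int n * j) / real n = 2 * pi * real_of_int j"
      using assms by simp
    then show ?thesis unfolding w_def by (simp only:) (simp add: cis_multiple_2pi)
  qed
  have w_mod: "w j = w (j mod int n)" for j
    using w_add[of "int n * (j div int n)" "j mod int n"] by (simp add: w_n)
  \<comment> \<open>Indexing the vertices by all integers, which repeats them with period
    \<open>n\<close>, makes invariance a mere shift of the index without wrap-around.\<close>
  have V: "{of_real r * cis (2 * pi * real k / real n) | k. k < n} = range (\<lambda>j. of_real r * w j)"
  proof (intro equalityI subsetI)
    fix x assume "x \<in> range (\<lambda>j. of_real r * w j)"
    then obtain j where j: "x = of_real r * w j" by auto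
    have "x = of_real r * cis (2 * pi * real (nat (j mod int n)) / real n)" "nat (j mod int n) < n"
      using assms w_mod[of j] by (auto simp: j w_def nat_less_iff)
    then show "x \<in> {of_real r * cis (2 * pi * real k / real n) | k. k < n}" by blast
  next
    fix x assume "x \<in> {of_real r * cis (2 * pi * real k / real n) | k. k < n}"
    then obtain k :: nat where "x = of_real r * cis (2 * pi * real k / real n)" by auto
    then have "x = of_real r * w (int k)" by (simp add: w_def)
    then show "x \<in> range (\<lambda>j. of_real r * w j)" by blast
  qed
  have sub: "w j * z \<in> regular_polygon n r" if "z \<in> regular_polygon n r" for j z
  proof -
    have "(*) (w j) ` range (\<lambda>j. of_real r * w j) \<subseteq> range (\<lambda>j. of_real r * w j)"
    proof
      fix x assume "x \<in> (*) (w j) ` range (\<lambda>j. of_real r * w j)"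
      then obtain i where "x = w j * (of_real r * w i)" by auto
      then have "x = of_real r * w (j + i)" by (simp add: w_add mult_ac)
      then show "x \<in> range (\<lambda>j. of_real r * w j)" by blast
    qed
    then have "convex hull ((*) (w j) ` range (\<lambda>j. of_real r * w j)) \<subseteq> regular_polygon n r"
      unfolding regular_polygon_def V by (rule hull_mono)
    moreover have "(*) (w j) ` regular_polygon n r = convex hull ((*) (w j) ` range (\<lambda>j. of_real r * w j))"
      unfolding regular_polygon_def V
      by (rule convex_hull_linear_image) (simp add: bounded_linear.linear[OF bounded_linear_mult_right])
    ultimately show ?thesis using that by blast
  qed
  have w_inv: "w (- int j) * (w (int j) * z) = z"
    using w_add[of "- int j" "int j"] by (simp add: w_def mult.assoc[symmetric])
  have w_nat: "cis (2 * pi * real j / real n) = w (int j)"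
    by (simp add: w_def)
  show ?thesis
    unfolding w_nat using sub[of z "int j"] sub[of "w (int j) * z" "- int j"] unfolding w_inv by blast
qed

text \<open>The centre is the average of the vertices, as the \<open>n\<close>-th roots of unity
  form a geometric progression with sum zero.\<close>

lemma zero_in_regular_polygon:
  assumes "n \<ge> 2"
  shows "0 \<in> regular_polygon n r"
proof -
  have v: "cis (2 * pi / real n) \<noteq> 1"
  proof
    assume "cis (2 * pi / real n) = 1"
    then have "cos (2 * pi / real n) = 1" by (simp add: complex_eq_iff)
    moreover have "cos (2 * pi / real n) < cos 0"
      using assms by (intro cos_monotone_0_pi) (auto simp: field_simps)
    ultimately show False by simp
  qed
  have "cis (2 * pi / real n) ^ n = 1"
    using assms by (subst Complex.DeMoivre) simp
  then have "(\<Sum>k<n. cis (2 * pi / real n) ^ k) = 0"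
    using v by (subst geometric_sum) auto
  then have "(\<Sum>k<n. cis (2 * pi * real k / real n)) = 0"
    by (simp add: Complex.DeMoivre mult_ac)
  then have "(\<Sum>k<n. (1 / real n) *\<^sub>R (of_real r * cis (2 * pi * real k / real n))) = 0"
    by (simp flip: sum_distrib_left scaleR_sum_right)
  moreover have "(\<Sum>k<n. (1 / real n) *\<^sub>R (of_real r * cis (2 * pi * real k / real n))) \<in> regular_polygon n r"
    unfolding regular_polygon_def
    using assms by (intro convex_sum) (auto intro!: hull_inc)
  ultimately show ?thesis by simp
qed

text \<open>The cosine is that of the angle between vertex \<open>k\<close> and the normal of the
  side joining vertices \<open>0\<close> and \<open>1\<close>. For \<open>k > 0\<close> this angle
  lies between \<open>pi / n\<close> and \<open>2 * pi - pi / n\<close>. The bound puts all vertices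
  on one side of the line through that side.\<close>

lemma cos_odd_multiple_le:
  assumes "k < n"
  shows "cos (2 * pi * real k / real n - pi / real n) \<le> cos (pi / real n)"
proof (cases "k = 0")
  case False
  define x where "x = 2 * pi * real k / real n - pi / real n"
  have x: "x = pi / n * (2 * real k - 1)" using assms by (simp add: x_def field_simps)
  have "pi / n * 1 \<le> x"
    using False assms unfolding x by (intro mult_left_mono) auto
  moreover have "x \<le> pi / n * (2 * n - 1)"
    using assms unfolding x by (intro mult_left_mono) auto
  then have "pi / n \<le> 2 * pi - x"
    using assms by (simp add: field_simps)
  \<comment> \<open>Angles beyond \<open>pi\<close> are reflected into the range where cosine
    decreases.\<close>
  moreover have "cos x = cos (2 * pi - x)" by simp
  moreover have "0 \<le> pi / n" by simp
  ultimately have "cos x \<le> cos (pi / n)"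
    using cos_monotone_0_pi_le[of "pi / n" x] cos_monotone_0_pi_le[of "pi / n" "2 * pi - x"]
    by (cases "x \<le> pi") auto
  then show ?thesis by (simp add: x_def)
qed simp

text \<open>If \<open>s + t \<le> 1\<close>, the point lies in the triangle spanned by the centre
  and two consecutive vertices. Conversely, the half-plane bounded by the side joining these
  vertices contains the polygon, and its defining functional takes the value
  \<open>r * (s + t) * cos (pi / n)\<close> at the point.\<close>

lemma regular_polygon_sector_iff:
  fixes s t r :: real
  assumes n: "n \<ge> 3" and r: "r > 0" and st: "s \<ge> 0" "t \<ge> 0"
  shows "of_real (r * s) + of_real (r * t) * cis (2 * pi / real n) \<in> regular_polygon n r \<longleftrightarrow> s + t \<le> 1"
    (is "?z \<in> _ \<longleftrightarrow> _")
proof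
  assume "s + t \<le> 1"
  moreover have "of_real r * cis (2 * pi * real k / real n) \<in> regular_polygon n r" if "k < n" for k
    unfolding regular_polygon_def using that by (blast intro: hull_inc)
  from this[of 0] this[of 1] n
  have "of_real r \<in> regular_polygon n r" "of_real r * cis (2 * pi / real n) \<in> regular_polygon n r"
    by auto
  moreover have "convex (regular_polygon n r)" by (simp add: regular_polygon_def)
  ultimately have "convex hull {of_real r, of_real r * cis (2 * pi / real n), 0} \<subseteq> regular_polygon n r"
    using n zero_in_regular_polygon[of n r] by (intro hull_minimal) auto
  moreover have "s *\<^sub>R of_real r + t *\<^sub>R (of_real r * cis (2 * pi / real n)) + (1 - s - t) *\<^sub>R 0 \<in>
      convex hull {of_real r, of_real r * cis (2 * pi / real n), 0}"
    unfolding convex_hull_3 using st \<open>s + t \<le> 1\<close> by (intro CollectI exI[of _ s] exI[of _ t] exI[of _ "1 - s - t"]) auto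
  ultimately have "s *\<^sub>R of_real r + t *\<^sub>R (of_real r * cis (2 * pi / real n)) + (1 - s - t) *\<^sub>R 0 \<in> regular_polygon n r"
    by blast
  then show "?z \<in> regular_polygon n r"
    by (simp add: scaleR_conv_of_real mult_ac)
next
  assume "?z \<in> regular_polygon n r"
  \<comment> \<open>\<^term>\<open>m\<close> is normal to the side through the vertices \<^term>\<open>r\<close> and \<^term>\<open>r * cis (2 * pi / n)\<close>.\<close>
  define m where "m = cis (pi / n)"
  have inner_m: "m \<bullet> cis x = cos (x - pi / n)" for x
    by (simp add: m_def inner_complex_def cos_diff mult_ac)
  have "regular_polygon n r \<subseteq> {w. m \<bullet> w \<le> r * cos (pi / n)}"
    unfolding regular_polygon_def
  proof (rule hull_minimal)
    show "{of_real r * cis (2 * pi * real k / real n) | k. k < n} \<subseteq> {w. m \<bullet> w \<le> r * cos (pi / n)}"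
      using r by (auto simp: inner_m cos_odd_multiple_le simp flip: scaleR_conv_of_real)
  qed (rule convex_halfspace_le)
  with \<open>?z \<in> regular_polygon n r\<close> have "m \<bullet> ?z \<le> r * cos (pi / n)" by blast
  moreover have "m \<bullet> ?z = r * (s + t) * cos (pi / n)"
  proof -
    have "?z = (r * s) *\<^sub>R cis 0 + (r * t) *\<^sub>R cis (2 * pi / real n)"
      by (simp add: scaleR_conv_of_real)
    moreover have "2 * pi / real n - pi / n = pi / n" by (simp add: field_simps)
    ultimately show ?thesis
      by (simp only: inner_add_right inner_scaleR_right inner_m) (simp add: algebra_simps)
  qed
  moreover have "cos (pi / n) > 0"
    using n by (intro cos_gt_zero_pi) (auto simp: field_simps intro: less_le_trans[of _ 0])
  ultimately show "s + t \<le> 1"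
    using r by (simp add: mult.assoc)
qed

section \<open>Rotated sectors tiling the punctured plane\<close>

text \<open>For \<open>0 < \<theta> < pi\<close> these are the points with argument in \<open>[0, \<theta>)\<close>, the origin excluded.\<close>

definition sector :: "real \<Rightarrow> complex set" where
  "sector \<theta> = {z. 0 \<le> Im z \<and> Im (z * cis (- \<theta>)) < 0}"

lemma sector_borel [measurable]: "sector \<theta> \<in> sets borel"
  unfolding sector_def by measurable

text \<open>Membership means \<open>sin \<phi> \<ge> 0\<close> and
  \<open>sin (\<phi> - \<theta>) < 0\<close>. The first forces \<open>\<phi> \<le> pi\<close>; the
  second then rules out \<open>\<phi> \<ge> \<theta>\<close>.\<close>

lemma polar_in_sector_iff:
  assumes \<theta>: "0 < \<theta>" "\<theta> < pi" and \<phi>: "0 \<le> \<phi>" "\<phi> < 2 * pi" and R: "R > 0"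
  shows "of_real R * cis \<phi> \<in> sector \<theta> \<longleftrightarrow> \<phi> < \<theta>"
proof -
  have "Im (of_real R * cis \<phi> * cis (- \<theta>)) = R * sin (\<phi> - \<theta>)"
    by (simp add: mult.assoc cis_mult)
  then have "of_real R * cis \<phi> \<in> sector \<theta> \<longleftrightarrow> 0 \<le> sin \<phi> \<and> sin (\<phi> - \<theta>) < 0"
    using R by (simp only: sector_def mem_Collect_eq) (simp add: zero_le_mult_iff mult_less_0_iff)
  also have "\<dots> \<longleftrightarrow> \<phi> < \<theta>"
  proof
    assume *: "0 \<le> sin \<phi> \<and> sin (\<phi> - \<theta>) < 0"
    have "\<phi> \<le> pi"
      using * \<phi> sin_lt_zero[of \<phi>] by (cases "\<phi> \<le> pi") auto
    then show "\<phi> < \<theta>"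
      using * \<theta> sin_ge_zero[of "\<phi> - \<theta>"] by (cases "\<phi> < \<theta>") auto
  next
    assume "\<phi> < \<theta>"
    then show "0 \<le> sin \<phi> \<and> sin (\<phi> - \<theta>) < 0"
      using \<theta> \<phi> sin_gt_zero[of "\<theta> - \<phi>"] by (auto intro: sin_ge_zero simp: sin_diff mult.commute)
  qed
  finally show ?thesis .
qed

text \<open>Exactly one rotated sector contains \<open>z\<close>: the one whose index is the integer
  part of the argument of \<open>z\<close> divided by the sector angle.\<close>

lemma sum_indicator_rotated_sector:
  assumes n: "n \<ge> 3" and z: "z \<noteq> 0"
  shows "(\<Sum>k<n. indicator (sector (2 * pi / n)) (cis (- (2 * pi * real k / n)) * z)) = (1 :: 'a :: semiring_1)"
proof -
  define \<theta> where "\<theta> = 2 * pi / n"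
  define \<phi> where "\<phi> = Arg2pi z"
  define R where "R = cmod z"
  have \<theta>: "0 < \<theta>" "\<theta> < pi" using n by (auto simp: \<theta>_def field_simps)
  have \<phi>: "0 \<le> \<phi>" "\<phi> < 2 * pi" using Arg2pi[of z] by (auto simp: \<phi>_def)
  have R: "R > 0" using z by (simp add: R_def)
  have z_eq: "z = of_real R * cis \<phi>"
    using Arg2pi_eq[of z] by (simp add: R_def \<phi>_def cis_conv_exp)
  have mem: "cis (- (k * \<theta>)) * z \<in> sector \<theta> \<longleftrightarrow> k = nat \<lfloor>\<phi> / \<theta>\<rfloor>" if "k < n" for k :: nat
  proof -
    have k: "real k + 1 \<le> n" using that by linarith
    then have "(real k + 1) * \<theta> \<le> n * \<theta>"
      using \<theta> by (intro mult_right_mono) auto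
    then have k_le: "k * \<theta> + \<theta> \<le> 2 * pi"
      using n by (simp add: \<theta>_def distrib_right add_divide_distrib)
    have rot: "cis (- (k * \<theta>)) * z = of_real R * cis (\<phi> - k * \<theta>)"
      by (simp add: z_eq mult.left_commute[of "cis _"] cis_mult)
    have "cis (- (k * \<theta>)) * z \<in> sector \<theta> \<longleftrightarrow> k * \<theta> \<le> \<phi> \<and> \<phi> < k * \<theta> + \<theta>"
    proof (cases "k * \<theta> \<le> \<phi>")
      case True
      have "0 \<le> k * \<theta>" using \<theta> by simp
      then have "\<phi> - k * \<theta> < 2 * pi" using \<phi> by linarith
      then show ?thesis
        using True \<phi> R \<theta> by (subst rot, subst polar_in_sector_iff) auto
    next
      case False
      \<comment> \<open>The angle is negative, so a full turn is added. The result is at least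
        \<open>\<theta>\<close> because \<open>k * \<theta> + \<theta> \<le> 2 * pi\<close>, hence
        outside the sector.\<close>
      have "of_real R * cis (\<phi> - k * \<theta>) = of_real R * cis (\<phi> - k * \<theta> + 2 * pi)"
        by (simp add: complex_eq_iff)
      then show ?thesis
        using False \<phi> R \<theta> k_le
        by (subst rot, simp only:, subst polar_in_sector_iff) auto
    qed
    also have "\<dots> \<longleftrightarrow> \<lfloor>\<phi> / \<theta>\<rfloor> = int k"
      using \<theta> by (simp add: floor_eq_iff field_simps)
    also have "\<dots> \<longleftrightarrow> k = nat \<lfloor>\<phi> / \<theta>\<rfloor>"
      using \<theta> \<phi> by (auto simp: nat_eq_iff)
    finally show ?thesis .
  qed
  have "\<phi> / \<theta> < n"
    using \<phi> \<theta> n by (simp add: \<theta>_def field_simps)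
  then have k0: "nat \<lfloor>\<phi> / \<theta>\<rfloor> < n"
    using \<theta> \<phi> by (simp add: nat_less_iff floor_less_iff)
  have "(\<Sum>k<n. indicator (sector \<theta>) (cis (- (k * \<theta>)) * z)) =
      (\<Sum>k<n. if k = nat \<lfloor>\<phi> / \<theta>\<rfloor> then 1 else 0 :: 'a)"
    by (intro sum.cong) (auto simp: mem split: split_indicator)
  also have "\<dots> = 1" using k0 by simp
  finally show ?thesis by (simp add: \<theta>_def mult_ac)
qed

subsection \<open>The uniform distribution on the regular polygon\<close>

lemma regular_polygon_compact: "compact (regular_polygon n r)"
  unfolding regular_polygon_def by (intro finite_imp_compact_convex_hull) simp

lemma regular_polygon_borel [measurable]: "regular_polygon n r \<in> sets borel"
  using regular_polygon_compact by (intro borel_closed compact_imp_closed)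

text \<open>The rotated sectors cut the integral into \<open>n\<close> pieces, equal because
  \<open>f\<close>, the polygon and Lebesgue measure are all rotation invariant. A linear map then
  carries the simplex onto one piece, with Jacobian
  \<open>r\<^sup>2 * sin (2 * pi / n)\<close>.\<close>

lemma nn_integral_regular_polygon:
  fixes f :: "complex \<Rightarrow> ennreal"
  assumes n: "n \<ge> 3" and r: "r > 0"
    and [measurable]: "f \<in> borel_measurable borel"
    and inv: "\<And>k z. f (cis (2 * pi * real k / real n) * z) = f z"
  shows "(\<integral>\<^sup>+z. f z * indicator (regular_polygon n r) z \<partial>lborel) =
    ennreal (real n * (r\<^sup>2 * sin (2 * pi / n))) *
    (\<integral>\<^sup>+z. f (of_real (r * Re z) + of_real (r * Im z) * cis (2 * pi / n)) * indicator unit_simplex z \<partial>lborel)"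
proof -
  define \<theta> where "\<theta> = 2 * pi / n"
  define P where "P = regular_polygon n r"
  define g where "g z = f z * indicator P z * indicator (sector \<theta>) z" for z
  have \<theta>: "0 < \<theta>" "\<theta> < pi" using n by (auto simp: \<theta>_def field_simps)
  then have sin_pos: "sin \<theta> > 0" by (rule sin_gt_zero)
  have [measurable]: "P \<in> sets borel" by (simp add: P_def)
  have [measurable]: "g \<in> borel_measurable borel" unfolding g_def by measurable
  have rot: "g (cis (- (2 * pi * real k / real n)) * z) =
      f z * indicator P z * indicator (sector \<theta>) (cis (- (2 * pi * real k / real n)) * z)" for k z
  proof -
    let ?z = "cis (- (2 * pi * real k / real n)) * z"
    have z: "cis (2 * pi * real k / real n) * ?z = z"
      by (simp add: mult.assoc[symmetric] cis_mult)
    then have "f ?z = f z" "?z \<in> P \<longleftrightarrow> z \<in> P"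
      using inv[of k ?z] regular_polygon_mult_cis[of n k ?z r] n unfolding z P_def by auto
    then show ?thesis by (simp add: g_def split: split_indicator)
  qed
  \<comment> \<open>The origin belongs to no sector, so the decomposition holds only almost
    everywhere.\<close>
  have "AE z in lborel. z \<noteq> (0::complex)" by (rule AE_lborel_singleton)
  then have "(\<integral>\<^sup>+z. f z * indicator P z \<partial>lborel) =
      (\<integral>\<^sup>+z. (\<Sum>k<n. g (cis (- (2 * pi * real k / real n)) * z)) \<partial>lborel)"
    by (intro nn_integral_cong_AE, eventually_elim)
       (use n in \<open>simp add: rot \<theta>_def sum_indicator_rotated_sector flip: sum_distrib_left\<close>)
  also have "\<dots> = (\<Sum>k<n. \<integral>\<^sup>+z. g (cis (- (2 * pi * real k / real n)) * z) \<partial>lborel)"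
    by (rule nn_integral_sum) simp
  also have "\<dots> = (\<Sum>k<n. \<integral>\<^sup>+z. g z \<partial>lborel)"
  proof (rule sum.cong)
    fix k
    have "(\<integral>\<^sup>+z. g (cis x * z) \<partial>lborel) = (\<integral>\<^sup>+z. g z \<partial>distr lborel borel (\<lambda>z. cis x * z))" for x
      by (rule nn_integral_distr[symmetric]) auto
    then show "(\<integral>\<^sup>+z. g (cis (- (2 * pi * real k / real n)) * z) \<partial>lborel) = (\<integral>\<^sup>+z. g z \<partial>lborel)"
      by (simp only: distr_lborel_cis_mult)
  qed simp
  also have "\<dots> = ennreal n * (\<integral>\<^sup>+z. g z \<partial>lborel)"
    by (simp add: ennreal_of_nat_eq_real_of_nat)
  \<comment> \<open>The columns of the matrix are the consecutive vertices \<open>r\<close> and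
    \<open>r * cis \<theta>\<close>.\<close>
  also have "(\<integral>\<^sup>+z. g z \<partial>lborel) = ennreal \<bar>r * (r * sin \<theta>) - r * cos \<theta> * 0\<bar> *
      (\<integral>\<^sup>+z. g (Complex (r * Re z + r * cos \<theta> * Im z) (0 * Re z + r * sin \<theta> * Im z)) \<partial>lborel)"
    using r sin_pos by (intro nn_integral_complex_linear) auto
  also have "(\<lambda>z. g (Complex (r * Re z + r * cos \<theta> * Im z) (0 * Re z + r * sin \<theta> * Im z))) =
      (\<lambda>z. f (of_real (r * Re z) + of_real (r * Im z) * cis \<theta>) * indicator unit_simplex z)"
  proof
    fix z
    let ?z = "of_real (r * Re z) + of_real (r * Im z) * cis \<theta>"
    have "Complex (r * Re z + r * cos \<theta> * Im z) (0 * Re z + r * sin \<theta> * Im z) = ?z"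
      by (simp add: complex_eq_iff)
    moreover have "?z \<in> sector \<theta> \<longleftrightarrow> 0 < Re z \<and> 0 \<le> Im z"
    proof -
      define q where "q = r * sin \<theta>"
      have "q > 0" using r sin_pos by (simp add: q_def)
      moreover have "Im ?z = Im z * q" by (simp add: q_def)
      moreover have "Im (?z * cis (- \<theta>)) = - (Re z * q)"
        by (simp add: q_def algebra_simps)
      ultimately show ?thesis
        unfolding sector_def mem_Collect_eq
        by (simp only:) (auto simp: zero_le_mult_iff zero_less_mult_iff)
    qed
    then have "?z \<in> P \<and> ?z \<in> sector \<theta> \<longleftrightarrow> z \<in> unit_simplex"
      using regular_polygon_sector_iff[OF n r, of "Re z" "Im z"]
      by (auto simp: unit_simplex_def P_def \<theta>_def)
    ultimately show "g (Complex (r * Re z + r * cos \<theta> * Im z) (0 * Re z + r * sin \<theta> * Im z)) =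
        f ?z * indicator unit_simplex z"
      by (auto simp: g_def split: split_indicator)
  qed
  finally show ?thesis
    using r sin_pos by (simp add: P_def \<theta>_def ennreal_mult power2_eq_square mult_ac)
qed

lemma emeasure_regular_polygon:
  assumes n: "n \<ge> 3" and r: "r > 0"
  shows "emeasure lborel (regular_polygon n r) = ennreal (real n * (r\<^sup>2 * sin (2 * pi / n)) / 2)"
proof -
  define D where "D = real n * (r\<^sup>2 * sin (2 * pi / n))"
  have "sin (2 * pi / n) \<ge> 0" using n by (intro sin_ge_zero) (auto simp: field_simps)
  then have D: "D \<ge> 0" by (simp add: D_def)
  have I: "has_bochner_integral lborel (indicator unit_simplex :: complex \<Rightarrow> real) (1 / 2)"
    using has_bochner_integral_unit_simplex[of 0 0] by simp
  have "(\<integral>\<^sup>+z. ennreal (indicator unit_simplex z) \<partial>lborel) = ennreal (1 / 2)"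
    using nn_integral_eq_integral[OF integrable.intros[OF I]]
    by (simp only: has_bochner_integral_integral_eq[OF I]) simp
  then have "(\<integral>\<^sup>+z. 1 * indicator unit_simplex z \<partial>(lborel :: complex measure)) = ennreal (1 / 2)"
    by (simp only: ennreal_indicator mult_1)
  moreover have "emeasure lborel (regular_polygon n r) =
      (\<integral>\<^sup>+z. 1 * indicator (regular_polygon n r) z \<partial>lborel)"
    by simp
  moreover have "\<dots> = ennreal D * (\<integral>\<^sup>+z. 1 * indicator unit_simplex z \<partial>(lborel :: complex measure))"
    unfolding D_def by (rule nn_integral_regular_polygon[OF n r]) auto
  moreover have "ennreal D * ennreal (1 / 2) = ennreal (D / 2)"
    using D by (subst ennreal_mult[symmetric]) auto
  ultimately show ?thesis by (simp only: D_def)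
qed

text \<open>The constant is the reciprocal of the area. Writing the density as a real function fits
  it to the density rule for Bochner integrals.\<close>

lemma uniform_measure_regular_polygon:
  assumes n: "n \<ge> 3" and r: "r > 0"
  shows "uniform_measure lborel (regular_polygon n r) =
    density lborel (\<lambda>z. ennreal (indicator (regular_polygon n r) z * (2 / (real n * (r\<^sup>2 * sin (2 * pi / n))))))"
  and "prob_space (uniform_measure lborel (regular_polygon n r))"
proof -
  have sin_pos: "sin (2 * pi / n) > 0" using n by (intro sin_gt_zero) (auto simp: field_simps)
  show "prob_space (uniform_measure lborel (regular_polygon n r))"
    using n r sin_pos
    by (intro prob_space_uniform_measure) (auto simp: emeasure_regular_polygon)
  show "uniform_measure lborel (regular_polygon n r) =
      density lborel (\<lambda>z. ennreal (indicator (regular_polygon n r) z * (2 / (real n * (r\<^sup>2 * sin (2 * pi / n))))))"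
    unfolding uniform_measure_def emeasure_regular_polygon[OF n r]
  proof (intro arg_cong2[of _ _ _ _ density] ext refl)
    fix z
    show "indicator (regular_polygon n r) z / ennreal (real n * (r\<^sup>2 * sin (2 * pi / n)) / 2) =
        ennreal (indicator (regular_polygon n r) z * (2 / (real n * (r\<^sup>2 * sin (2 * pi / n)))))"
      using n r sin_pos divide_ennreal[of 1 "real n * (r\<^sup>2 * sin (2 * pi / n)) / 2"]
      by (auto split: split_indicator)
  qed
qed

section \<open>Moments of one uniform point\<close>

text \<open>The integral over the polygon is \<open>D * I\<close> and the area is
  \<open>D / 2\<close>, so the mean is \<open>2 * I\<close> whatever \<open>D\<close> is.\<close>

lemma has_bochner_integral_uniform_regular_polygon:
  fixes f :: "complex \<Rightarrow> real"
  assumes n: "n \<ge> 3" and r: "r > 0"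
    and [measurable]: "f \<in> borel_measurable borel" and nonneg: "\<And>z. f z \<ge> 0"
    and inv: "\<And>k z. f (cis (2 * pi * real k / real n) * z) = f z"
    and I: "has_bochner_integral lborel
      (\<lambda>z. f (of_real (r * Re z) + of_real (r * Im z) * cis (2 * pi / n)) * indicator unit_simplex z) I"
  shows "has_bochner_integral (uniform_measure lborel (regular_polygon n r)) f (2 * I)"
proof -
  define D where "D = real n * (r\<^sup>2 * sin (2 * pi / n))"
  have "sin (2 * pi / n) > 0" using n by (intro sin_gt_zero) (auto simp: field_simps)
  then have D: "D > 0" using n r by (simp add: D_def)
  have I_nonneg: "I \<ge> 0"
    using I nonneg by (auto simp: has_bochner_integral_iff)
  have "(\<integral>\<^sup>+z. ennreal (f (of_real (r * Re z) + of_real (r * Im z) * cis (2 * pi / n)) *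
      indicator unit_simplex z) \<partial>lborel) = ennreal I"
    using I nonneg by (subst nn_integral_eq_integral) (auto simp: has_bochner_integral_iff)
  then have "(\<integral>\<^sup>+z. ennreal (f z) * indicator (regular_polygon n r) z \<partial>lborel) = ennreal D * ennreal I"
    by (subst nn_integral_regular_polygon[OF n r])
       (auto simp: inv D_def ennreal_mult' nonneg ennreal_indicator[symmetric] simp flip: of_real_mult)
  then have "has_bochner_integral lborel (\<lambda>z. f z * indicator (regular_polygon n r) z) (D * I)"
    using D I_nonneg nonneg
    by (intro has_bochner_integral_nn_integral)
       (auto simp: ennreal_mult' ennreal_indicator)
  then have "has_bochner_integral lborel (\<lambda>z. 2 / D * (f z * indicator (regular_polygon n r) z)) (2 / D * (D * I))"
    by (rule has_bochner_integral_mult_right)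
  then show ?thesis
    unfolding uniform_measure_regular_polygon(1)[OF n r] D_def[symmetric] using D
    by (intro has_bochner_integral_density) (auto simp: mult_ac)
qed

text \<open>Rotating the integration variable gives \<open>J = w * J\<close> for the integral
  \<open>J\<close> over the polygon, and \<open>w \<noteq> 1\<close> forces \<open>J = 0\<close>.
  Continuity on a compact set supplies integrability.\<close>

lemma has_bochner_integral_uniform_regular_polygon_eq_0:
  fixes f :: "complex \<Rightarrow> complex"
  assumes n: "n \<ge> 3" and r: "r > 0" and cont: "continuous_on UNIV f"
    and rot: "\<And>z. f (cis (2 * pi / real n) * z) = w * f z" and w: "w \<noteq> 1"
  shows "has_bochner_integral (uniform_measure lborel (regular_polygon n r)) f 0"
proof -
  define P where "P = regular_polygon n r"
  define D where "D = real n * (r\<^sup>2 * sin (2 * pi / n))"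
  have "sin (2 * pi / n) > 0" using n by (intro sin_gt_zero) (auto simp: field_simps)
  then have D: "D > 0" using n r by (simp add: D_def)
  have [measurable]: "f \<in> borel_measurable borel" "P \<in> sets borel"
    using cont by (auto simp: P_def intro: borel_measurable_continuous_onI)
  have int: "integrable lborel (\<lambda>z. indicator P z *\<^sub>R f z)"
    using cont regular_polygon_compact unfolding P_def
    by (intro borel_integrable_compact) (auto intro: continuous_on_subset)
  define J where "J = (\<integral>z. indicator P z *\<^sub>R f z \<partial>lborel)"
  have "J = (\<integral>z. indicator P z *\<^sub>R f z \<partial>distr lborel borel (\<lambda>z. cis (2 * pi / n) * z))"
    by (simp add: J_def distr_lborel_cis_mult)
  also have "\<dots> = (\<integral>z. indicator P (cis (2 * pi / n) * z) *\<^sub>R f (cis (2 * pi / n) * z) \<partial>lborel)"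
    by (rule integral_distr) auto
  also have "\<dots> = (\<integral>z. w * (indicator P z *\<^sub>R f z) \<partial>lborel)"
    using regular_polygon_mult_cis[of n 1 _ r] n
    by (intro Bochner_Integration.integral_cong) (auto simp: P_def rot split: split_indicator)
  also have "\<dots> = w * J"
    unfolding J_def by (rule integral_mult_right_zero)
  finally have "(1 - w) * J = 0" by (simp add: algebra_simps)
  then have "has_bochner_integral lborel (\<lambda>z. indicator P z *\<^sub>R f z) 0"
    using int w by (auto simp: has_bochner_integral_iff J_def)
  then have "has_bochner_integral lborel (\<lambda>z. (2 / D) *\<^sub>R (indicator P z *\<^sub>R f z)) ((2 / D) *\<^sub>R 0)"
    by (rule has_bochner_integral_scaleR_right)
  then show ?thesis
    unfolding uniform_measure_regular_polygon(1)[OF n r] D_def[symmetric] unfolding P_def[symmetric] using D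
    by (intro has_bochner_integral_density) (auto simp: mult_ac divide_inverse)
qed

lemma uniform_regular_polygon_norm_moments:
  assumes n: "n \<ge> 3" and r: "r > 0"
  defines "c \<equiv> cos (2 * pi / n)"
  shows "has_bochner_integral (uniform_measure lborel (regular_polygon n r)) (\<lambda>z. (cmod z)\<^sup>2) (r\<^sup>2 * (2 + c) / 6)"
    and "has_bochner_integral (uniform_measure lborel (regular_polygon n r)) (\<lambda>z. cmod z ^ 4)
      (r ^ 4 * (7 + 6 * c + 2 * c\<^sup>2) / 45)"
proof -
  have norm2: "(cmod (of_real (r * s) + of_real (r * t) * cis (2 * pi / n)))\<^sup>2 = r\<^sup>2 * (s\<^sup>2 + t\<^sup>2 + 2 * c * (s * t))" for s t
  proof -
    have "(cmod (of_real (r * s) + of_real (r * t) * cis (2 * pi / n)))\<^sup>2 =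
        (r * s + r * t * c)\<^sup>2 + (r * t * sin (2 * pi / n))\<^sup>2"
      by (simp add: cmod_power2 c_def)
    also have "\<dots> = r\<^sup>2 * (s\<^sup>2 + t\<^sup>2 * (c\<^sup>2 + (sin (2 * pi / n))\<^sup>2) + 2 * c * (s * t))"
      by algebra
    finally show ?thesis by (simp add: c_def)
  qed
  have norm4: "cmod z ^ 4 = ((cmod z)\<^sup>2)\<^sup>2" for z by simp
  let ?m = "\<lambda>a b z. Re z ^ a * Im z ^ b * indicator unit_simplex z :: real"
  \<comment> \<open>By the law of cosines the squared norm is a quadratic form in the simplex
    coordinates, so the mean is a sum of Dirichlet integrals.\<close>
  have "has_bochner_integral lborel (\<lambda>z. r\<^sup>2 * (?m 2 0 z + ?m 0 2 z + 2 * c * ?m 1 1 z))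
      (r\<^sup>2 * (fact 2 * fact 0 / fact (2 + 0 + 2) + fact 0 * fact 2 / fact (0 + 2 + 2) +
        2 * c * (fact 1 * fact 1 / fact (1 + 1 + 2))))"
    by (intro has_bochner_integral_mult_right has_bochner_integral_add has_bochner_integral_unit_simplex)
  also have "(\<lambda>z. r\<^sup>2 * (?m 2 0 z + ?m 0 2 z + 2 * c * ?m 1 1 z)) =
      (\<lambda>z. r\<^sup>2 * ((Re z)\<^sup>2 + (Im z)\<^sup>2 + 2 * c * (Re z * Im z)) * indicator unit_simplex z)"
    by (auto simp: algebra_simps split: split_indicator)
  also have "r\<^sup>2 * (fact 2 * fact 0 / fact (2 + 0 + 2) + fact 0 * fact 2 / fact (0 + 2 + 2) +
        2 * c * (fact 1 * fact 1 / fact (1 + 1 + 2))) = r\<^sup>2 * (2 + c) / 12"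
    by (simp add: fact_numeral field_simps)
  finally have "has_bochner_integral (uniform_measure lborel (regular_polygon n r)) (\<lambda>z. (cmod z)\<^sup>2)
      (2 * (r\<^sup>2 * (2 + c) / 12))"
    using n r by (intro has_bochner_integral_uniform_regular_polygon)
      (auto simp only: norm2 norm_mult norm_cis mult_1 zero_le_power2
        borel_measurable_power borel_measurable_norm measurable_ident_sets)
  then show "has_bochner_integral (uniform_measure lborel (regular_polygon n r)) (\<lambda>z. (cmod z)\<^sup>2) (r\<^sup>2 * (2 + c) / 6)"
    by (simp add: mult.commute)
  \<comment> \<open>The coefficients come from squaring
    \<open>s\<^sup>2 + t\<^sup>2 + 2 * c * (s * t)\<close>.\<close>
  have "has_bochner_integral lborel
      (\<lambda>z. r ^ 4 * (?m 4 0 z + ?m 0 4 z + (2 + 4 * c\<^sup>2) * ?m 2 2 z + 4 * c * (?m 3 1 z + ?m 1 3 z)))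
      (r ^ 4 * (fact 4 * fact 0 / fact (4 + 0 + 2) + fact 0 * fact 4 / fact (0 + 4 + 2) +
        (2 + 4 * c\<^sup>2) * (fact 2 * fact 2 / fact (2 + 2 + 2)) +
        4 * c * (fact 3 * fact 1 / fact (3 + 1 + 2) + fact 1 * fact 3 / fact (1 + 3 + 2))))"
    by (intro has_bochner_integral_mult_right has_bochner_integral_add has_bochner_integral_unit_simplex)
  also have "(\<lambda>z. r ^ 4 * (?m 4 0 z + ?m 0 4 z + (2 + 4 * c\<^sup>2) * ?m 2 2 z + 4 * c * (?m 3 1 z + ?m 1 3 z))) =
      (\<lambda>z. (r\<^sup>2 * ((Re z)\<^sup>2 + (Im z)\<^sup>2 + 2 * c * (Re z * Im z)))\<^sup>2 * indicator unit_simplex z)"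
    by (auto simp: power2_eq_square power4_eq_xxxx power3_eq_cube algebra_simps split: split_indicator)
  also have "r ^ 4 * (fact 4 * fact 0 / fact (4 + 0 + 2) + fact 0 * fact 4 / fact (0 + 4 + 2) +
        (2 + 4 * c\<^sup>2) * (fact 2 * fact 2 / fact (2 + 2 + 2)) +
        4 * c * (fact 3 * fact 1 / fact (3 + 1 + 2) + fact 1 * fact 3 / fact (1 + 3 + 2))) =
      r ^ 4 * (7 + 6 * c + 2 * c\<^sup>2) / 90"
    by (simp add: fact_numeral field_simps)
  finally have "has_bochner_integral (uniform_measure lborel (regular_polygon n r)) (\<lambda>z. cmod z ^ 4)
      (2 * (r ^ 4 * (7 + 6 * c + 2 * c\<^sup>2) / 90))"
    unfolding norm4
    using n r by (intro has_bochner_integral_uniform_regular_polygon)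
      (auto simp only: norm2 norm_mult norm_cis mult_1 zero_le_power2
        borel_measurable_power borel_measurable_norm measurable_ident_sets)
  then show "has_bochner_integral (uniform_measure lborel (regular_polygon n r)) (\<lambda>z. cmod z ^ 4)
      (r ^ 4 * (7 + 6 * c + 2 * c\<^sup>2) / 45)"
    by simp
qed

section \<open>Fourth moment of the distance\<close>

text \<open>Equality would make \<open>n\<close> divide the smaller positive number
  \<open>m\<close>. The cases \<open>m = 1\<close> and \<open>m = 2\<close> provide the nontrivial
  rotation factors for the vanishing means.\<close>

lemma cis_power_ne_1:
  assumes "0 < m" "m < n"
  shows "cis (2 * pi / real n) ^ m \<noteq> 1"
proof
  assume "cis (2 * pi / real n) ^ m = 1"
  then have "cos (real m * (2 * pi / real n)) = 1"
    by (simp add: Complex.DeMoivre complex_eq_iff)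
  then obtain k :: int where "real m * (2 * pi / real n) = of_int k * 2 * pi"
    unfolding cos_one_2pi_int by auto
  then have "real m = real_of_int k * real n"
    using assms by (simp add: field_simps)
  then have "int m = k * int n" by (metis of_int_eq_iff of_int_mult of_int_of_nat_eq)
  then have "int n dvd int m" by simp
  with assms show False by (auto dest: zdvd_imp_le)
qed

text \<open>Square \<open>\<bar>x\<bar>\<^sup>2 + \<bar>y\<bar>\<^sup>2 - 2 * Re w\<close> with
  \<open>w = cnj x * y\<close>, and rewrite \<open>4 * (Re w)\<^sup>2\<close> as
  \<open>2 * \<bar>w\<bar>\<^sup>2 + 2 * Re (w\<^sup>2)\<close>. Each term under the final
  \<open>Re\<close> is a factor free of \<open>y\<close> times a function of \<open>y\<close> with
  mean zero.\<close>

lemma dist_power4_expand: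
  fixes x y :: complex
  shows "dist x y ^ 4 = cmod x ^ 4 + cmod y ^ 4 + 4 * (cmod x)\<^sup>2 * (cmod y)\<^sup>2
    + Re (2 * cnj (x\<^sup>2) * y\<^sup>2 - 4 * of_real ((cmod x)\<^sup>2) * cnj x * y - 4 * cnj x * (of_real ((cmod y)\<^sup>2) * y))"
proof -
  obtain a b a' b' where xy: "x = Complex a b" "y = Complex a' b'"
    by (cases x, cases y) auto
  have norm4: "cmod z ^ 4 = ((cmod z)\<^sup>2)\<^sup>2" for z by simp
  show ?thesis
    unfolding xy dist_norm norm4 cmod_power2
    by (simp add: power2_eq_square algebra_simps)
qed

theorem theorem5:
  fixes n :: nat and r :: real
  assumes "n \<ge> 3" and "r > 0"
  shows "distance_moment 4 (regular_polygon n r) =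
    r ^ 4 / 90 * (77 + 64 * cos (2 * pi / real n) + 9 * cos (4 * pi / real n))"
proof -
  define c where "c = cos (2 * pi / n)"
  define \<omega> where "\<omega> = cis (2 * pi / real n)"
  define U where "U = uniform_measure lborel (regular_polygon n r)"
  define m2 where "m2 = r\<^sup>2 * (2 + c) / 6"
  define m4 where "m4 = r ^ 4 * (7 + 6 * c + 2 * c\<^sup>2) / 45"
  interpret U: prob_space U
    unfolding U_def using assms by (rule uniform_measure_regular_polygon(2))
  interpret UU: pair_sigma_finite U U ..
  have [measurable_cong]: "sets U = sets borel" by (simp add: U_def)
  have m2: "has_bochner_integral U (\<lambda>z. (cmod z)\<^sup>2) m2"
    and m4: "has_bochner_integral U (\<lambda>z. cmod z ^ 4) m4"
    unfolding U_def m2_def m4_def c_def by (fact uniform_regular_polygon_norm_moments[OF assms])+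
  have \<omega>: "\<omega> \<noteq> 1" "\<omega>\<^sup>2 \<noteq> 1"
    using cis_power_ne_1[of 1 n] cis_power_ne_1[of 2 n] assms by (auto simp: \<omega>_def)
  \<comment> \<open>Rotation multiplies \<open>y\<close> and
    \<open>\<bar>y\<bar>\<^sup>2 * y\<close> by \<open>\<omega>\<close>, and
    \<open>y\<^sup>2\<close> by \<open>\<omega>\<^sup>2\<close>.\<close>
  have zero: "has_bochner_integral U (\<lambda>y. y) 0" "has_bochner_integral U (\<lambda>y. y\<^sup>2) 0"
    "has_bochner_integral U (\<lambda>y. of_real ((cmod y)\<^sup>2) * y) 0"
    unfolding U_def
    by (rule has_bochner_integral_uniform_regular_polygon_eq_0[OF assms _ _ \<omega>(1)]
             has_bochner_integral_uniform_regular_polygon_eq_0[OF assms _ _ \<omega>(2)],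
        auto intro!: continuous_intros simp: \<omega>_def power_mult_distrib norm_mult)+
  have inner: "has_bochner_integral U (\<lambda>y. dist x y ^ 4) (cmod x ^ 4 + m4 + 4 * (cmod x)\<^sup>2 * m2)" for x
  proof -
    have "has_bochner_integral U
        (\<lambda>y. 2 * cnj (x\<^sup>2) * y\<^sup>2 - 4 * of_real ((cmod x)\<^sup>2) * cnj x * y - 4 * cnj x * (of_real ((cmod y)\<^sup>2) * y))
        (2 * cnj (x\<^sup>2) * 0 - 4 * of_real ((cmod x)\<^sup>2) * cnj x * 0 - 4 * cnj x * 0)"
      by (intro has_bochner_integral_diff has_bochner_integral_mult_right zero)
    from has_bochner_integral_bounded_linear[OF bounded_linear_Re this]
    have Re: "has_bochner_integral U (\<lambda>y. Re (2 * cnj (x\<^sup>2) * y\<^sup>2 - 4 * of_real ((cmod x)\<^sup>2) * cnj x * y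
        - 4 * cnj x * (of_real ((cmod y)\<^sup>2) * y))) 0"
      by simp
    have const: "has_bochner_integral U (\<lambda>y. cmod x ^ 4) (cmod x ^ 4)"
      by (simp add: has_bochner_integral_iff U.prob_space)
    \<comment> \<open>The final \<open>0\<close> is the mean of the \<open>Re\<close> part of the
      expansion.\<close>
    have "has_bochner_integral U (\<lambda>y. dist x y ^ 4) (cmod x ^ 4 + m4 + 4 * (cmod x)\<^sup>2 * m2 + 0)"
      unfolding dist_power4_expand
      by (intro has_bochner_integral_add has_bochner_integral_mult_right const m2 m4 Re)
    then show ?thesis by simp
  qed
  have outer: "has_bochner_integral U (\<lambda>x. cmod x ^ 4 + m4 + 4 * (cmod x)\<^sup>2 * m2) (m4 + m4 + 4 * m2 * m2)"
  proof -
    have "has_bochner_integral U (\<lambda>y. m4) m4"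
      by (simp add: has_bochner_integral_iff U.prob_space)
    then show ?thesis
      by (intro has_bochner_integral_add has_bochner_integral_mult_right has_bochner_integral_mult_left m2 m4)
  qed
  \<comment> \<open>The integrand is nonnegative, so \<open>inner\<close> and \<open>outer\<close>
    also bound the iterated integral of its absolute value, as Fubini requires.\<close>
  have "integrable (U \<Otimes>\<^sub>M U) (\<lambda>(x, y). dist x y ^ 4)"
    using inner outer by (intro UU.Fubini_integrable) (auto simp: has_bochner_integral_iff)
  from UU.integral_fst'[OF this]
  have "distance_moment 4 (regular_polygon n r) = (\<integral>x. \<integral>y. dist x y ^ 4 \<partial>U \<partial>U)"
    by (simp add: distance_moment_def U_def)
  also have "\<dots> = 2 * m4 + 4 * m2\<^sup>2"
    using inner outer by (simp add: has_bochner_integral_iff power2_eq_square)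
  \<comment> \<open>The bracket is \<open>68 + 64 * c + 18 * c\<^sup>2\<close>, regrouped to expose
    the double-angle expression \<open>2 * c\<^sup>2 - 1\<close>.\<close>
  also have "\<dots> = r ^ 4 / 90 * (77 + 64 * c + 9 * (2 * c\<^sup>2 - 1))"
    by (simp add: m2_def m4_def power2_eq_square power4_eq_xxxx field_simps)
  also have "2 * c\<^sup>2 - 1 = cos (4 * pi / real n)"
    using cos_double_cos[of "2 * pi / n"] by (simp add: c_def)
  also have "c = cos (2 * pi / real n)"
    by (simp add: c_def)
  finally show ?thesis .
qed

end
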